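(* Let $m_1,m_2,m_3>0$ and put $$\Sigma=\frac{(m_3 m_2)^{3/2}}{(m_3+m_2)^{1/2}}+\frac{(m_1 m_3)^{3/2}}{(m_1+m_3)^{1/2}}+\frac{(m_2 m_1)^{3/2}}{(m_2+m_1)^{1/2}} .$$ Let $\alpha>0$ and $T=\dfrac{\pi\,\Sigma}{\alpha^{3/2}}$. Let $t\mapsto (z_1(t),z_2(t),z_3(t))\in\mathbb{C}^3$ be a solution of the planar Newtonian three-body problem with masses $m_1,m_2,m_3$ and centre of mass at the origin, with negative energy $H=-\alpha$ (and arbitrary angular momentum). Assume that the configuration of the bodies at $t=0$ is antisymmetric and that the solution is collision-free for $t\in[0,T]$. Then there exists $t_0\in[0,T]$ such that the three bodies attain a generalised syzygy at time $t=t_0$.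
   Context: The planar Newtonian three-body problem with masses $m_1,m_2,m_3>0$ is the system, for $z_k=x_k+iy_k\in\mathbb{C}$ and $z_{kl}=z_k-z_l$, $$\ddot z_1=m_2\frac{z_{21}}{|z_{21}|^3}-m_3\frac{z_{13}}{|z_{13}|^3},\quad \ddot z_2=m_3\frac{z_{32}}{|z_{32}|^3}-m_1\frac{z_{21}}{|z_{21}|^3},\quad \ddot z_3=m_1\frac{z_{13}}{|z_{13}|^3}-m_2\frac{z_{32}}{|z_{32}|^3}.$$ Standing assumption: $\sum_k m_k z_k=\sum_k m_k\dot z_k=0$ (centre of mass at the origin). Collision-free on $[0,T]$ means that the solution is defined on $[0,T]$ and $z_j(t)\ne z_k(t)$ for all $j\neq k$ and $t\in[0,T]$. The energy is $$H=K-U,\qquad K=\tfrac12\sum_{k=1}^3 m_k|\dot z_k|^2,\qquad U=\frac{m_3m_2}{|z_{32}|}+\frac{m_1m_3}{|z_{13}|}+\frac{m_2m_1}{|z_{21}|}.$$ Generalised syzygy at time $t_0$: at least one of the triplets $(z_1,z_2,z_3)(t_0)$ (positions) or $(\dot z_1,\dot z_2,\dot z_3)(t_0)$ (velocities) is contained in a single straight line through the origin. Antisymmetric configuration at time $t_0$: for some $j\ne k$, $$(x_jy_k-y_jx_k)(t_0)\cdot(\dot x_j\dot y_k-\dot y_j\dot x_k)(t_0)<0 .$$ *)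

theory Defs
  imports "HOL-Analysis.Analysis"
begin

text \<open>
  The masses form a vector of type \<^typ>\<open>real ^ 3\<close>, the positions and the velocities of the three
  bodies form vectors of type \<^typ>\<open>complex ^ 3\<close>.
\<close>

definition acceleration :: "real ^ 3 \<Rightarrow> complex ^ 3 \<Rightarrow> complex ^ 3" where
  "acceleration m z =
     (let z21 = z $ 2 - z $ 1; z13 = z $ 1 - z $ 3; z32 = z $ 3 - z $ 2 in
      vector
        [(m $ 2) *\<^sub>R (z21 /\<^sub>R norm z21 ^ 3) - (m $ 3) *\<^sub>R (z13 /\<^sub>R norm z13 ^ 3),
         (m $ 3) *\<^sub>R (z32 /\<^sub>R norm z32 ^ 3) - (m $ 1) *\<^sub>R (z21 /\<^sub>R norm z21 ^ 3),
         (m $ 1) *\<^sub>R (z13 /\<^sub>R norm z13 ^ 3) - (m $ 2) *\<^sub>R (z32 /\<^sub>R norm z32 ^ 3)])"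

text \<open>
  The derivatives are relative to \<open>I\<close>, hence one-sided at the end points of a compact interval.
  At a collision the right-hand side has a junk value because of division by zero, so this
  predicate is meaningful only together with \<open>collision_free_on\<close> below.
\<close>

definition three_body_solution_on ::
    "real set \<Rightarrow> real ^ 3 \<Rightarrow> (real \<Rightarrow> complex ^ 3) \<Rightarrow> (real \<Rightarrow> complex ^ 3) \<Rightarrow> bool" where
  "three_body_solution_on I m z v \<longleftrightarrow>
     (\<forall>t\<in>I. (z has_vector_derivative v t) (at t within I) \<and>
            (v has_vector_derivative acceleration m (z t)) (at t within I))"

definition collision_free_on :: "real set \<Rightarrow> (real \<Rightarrow> complex ^ 3) \<Rightarrow> bool" where
  "collision_free_on I z \<longleftrightarrow> (\<forall>t\<in>I. \<forall>j k. j \<noteq> k \<longrightarrow> z t $ j \<noteq> z t $ k)"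

definition kinetic_energy :: "real ^ 3 \<Rightarrow> complex ^ 3 \<Rightarrow> real" where
  "kinetic_energy m v = 1 / 2 * (\<Sum>k\<in>UNIV. m $ k * norm (v $ k) ^ 2)"

text \<open>With the sign convention \<open>H = K - U\<close>, i.e. \<open>U\<close> is positive.\<close>

definition force_function :: "real ^ 3 \<Rightarrow> complex ^ 3 \<Rightarrow> real" where
  "force_function m z =
     m $ 3 * m $ 2 / norm (z $ 3 - z $ 2) +
     m $ 1 * m $ 3 / norm (z $ 1 - z $ 3) +
     m $ 2 * m $ 1 / norm (z $ 2 - z $ 1)"

definition energy :: "real ^ 3 \<Rightarrow> complex ^ 3 \<Rightarrow> complex ^ 3 \<Rightarrow> real" where
  "energy m z v = kinetic_energy m v - force_function m z"

definition on_line_through_origin :: "complex ^ 3 \<Rightarrow> bool" where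
  "on_line_through_origin w \<longleftrightarrow> (\<exists>u. u \<noteq> 0 \<and> (\<forall>k. w $ k \<in> span {u}))"

definition generalised_syzygy :: "complex ^ 3 \<Rightarrow> complex ^ 3 \<Rightarrow> bool" where
  "generalised_syzygy z v \<longleftrightarrow> on_line_through_origin z \<or> on_line_through_origin v"

definition antisymmetric_configuration :: "complex ^ 3 \<Rightarrow> complex ^ 3 \<Rightarrow> bool" where
  "antisymmetric_configuration z v \<longleftrightarrow>
     (\<exists>j k. j \<noteq> k \<and>
        (Re (z $ j) * Im (z $ k) - Im (z $ j) * Re (z $ k)) *
        (Re (v $ j) * Im (v $ k) - Im (v $ j) * Re (v $ k)) < 0)"

definition mass_sum :: "real ^ 3 \<Rightarrow> real" where
  "mass_sum m =
     (m $ 3 * m $ 2) powr (3 / 2) / (m $ 3 + m $ 2) powr (1 / 2) +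
     (m $ 1 * m $ 3) powr (3 / 2) / (m $ 1 + m $ 3) powr (1 / 2) +
     (m $ 2 * m $ 1) powr (3 / 2) / (m $ 2 + m $ 1) powr (1 / 2)"

end

theory Submission
  imports Defs
begin

text \<open>
  Let \<open>S\<close> be the oriented area spanned by \<open>z\<^sub>1, z\<^sub>2\<close> and \<open>W\<close> the one spanned by the velocities
  \<open>v\<^sub>1, v\<^sub>2\<close>. As the centre of mass rests at the origin, the areas spanned by the other pairs of
  bodies are fixed nonzero multiples of these two. Hence the bodies are in generalised syzygy as soon
  as \<open>S\<close> or \<open>W\<close> vanishes, and an antisymmetric configuration has \<open>S W < 0\<close>. Newton's equations give
  \<open>S'' = 2 W - \<lambda> S\<close>, where \<open>\<lambda>\<close> is the sum of \<open>(m\<^sub>j + m\<^sub>k) / r\<^sub>j\<^sub>k\<^sup>3\<close> over the pairs of bodies and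
  \<open>r\<^sub>j\<^sub>k\<close> denotes the mutual distances.

  The energy is conserved and \<open>K \<ge> 0\<close>, so \<open>U \<ge> \<alpha>\<close>. Both \<open>U\<close> and \<open>\<lambda>\<close> are functions of the mutual
  distances, and Hoelder's inequality turns the bound on \<open>U\<close> into \<open>\<lambda> \<ge> \<omega>\<^sup>2\<close> with
  \<open>\<omega> = \<alpha>\<^sup>3\<^sup>/\<^sup>2 / \<Sigma> = \<pi> / T\<close> (lemma \<open>force_trace_lower_bound\<close>); the mass sum \<open>\<Sigma>\<close> is precisely the
  constant in that inequality.

  If no generalised syzygy occurred, then \<open>S\<close> and \<open>W\<close> would keep their opposite signs on \<open>[0, T]\<close>,
  so that, up to an overall sign, \<open>S > 0\<close> and \<open>S'' \<le> - \<omega>\<^sup>2 S\<close>. But comparison with \<open>sin (\<omega> t)\<close>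
  (lemma \<open>no_positive_solution_on_half_period\<close>) shows that such a function has a zero within the
  half period \<open>\<pi> / \<omega> = T\<close>.
\<close>

section \<open>Sturm comparison with the harmonic oscillator\<close>

text \<open>
  The Wronskian of \<open>f\<close> and \<open>sin (\<omega> t)\<close> is nonincreasing on the half period, but its end values are
  \<open>- \<omega> f(0) < 0\<close> and \<open>\<omega> f(\<pi> / \<omega>) > 0\<close>.
\<close>

lemma no_positive_solution_on_half_period:
  fixes f f' f'' :: "real \<Rightarrow> real"
  assumes \<omega>: "\<omega> > 0" and T: "T = pi / \<omega>"
    and f: "\<And>t. t \<in> {0..T} \<Longrightarrow> (f has_real_derivative f' t) (at t within {0..T})"
    and f': "\<And>t. t \<in> {0..T} \<Longrightarrow> (f' has_real_derivative f'' t) (at t within {0..T})"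
    and le: "\<And>t. t \<in> {0..T} \<Longrightarrow> f'' t \<le> - (\<omega>\<^sup>2 * f t)"
    and pos: "\<And>t. t \<in> {0..T} \<Longrightarrow> f t > 0"
  shows False
proof -
  define g where "g t = f' t * sin (\<omega> * t) - \<omega> * f t * cos (\<omega> * t)" for t
  have "T > 0" using \<omega> T by simp
  have g': "(g has_real_derivative (f'' t + \<omega>\<^sup>2 * f t) * sin (\<omega> * t)) (at t within {0..T})"
    if "t \<in> {0..T}" for t
    unfolding g_def
    by (rule derivative_eq_intros f[OF that] f'[OF that] refl)+
       (simp add: algebra_simps power2_eq_square)
  have "(f'' t + \<omega>\<^sup>2 * f t) * sin (\<omega> * t) \<le> 0" if "t \<in> {0..T}" for t
  proof (rule mult_nonpos_nonneg)
    show "f'' t + \<omega>\<^sup>2 * f t \<le> 0" using le[OF that] by simp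
    show "0 \<le> sin (\<omega> * t)"
      using that \<omega> T by (intro sin_ge_zero) (auto simp: field_simps)
  qed
  then have dec: "\<exists>y. (g has_real_derivative y) (at t) \<and> y \<le> 0" if "0 < t" "t < T" for t
    using that g'[of t] at_within_Icc_at[of 0 t T] by force
  have cont: "continuous_on {0..T} g"
    using g' by (rule DERIV_continuous_on)
  have "g T \<le> g 0"
    by (rule DERIV_nonpos_imp_decreasing_open[OF less_imp_le[OF \<open>T > 0\<close>] dec cont])
  moreover have "g 0 < 0" "g T > 0"
    using pos[of 0] pos[of T] \<omega> \<open>T > 0\<close> T by (auto simp: g_def)
  ultimately show False by simp
qed

section \<open>Hoelder's inequality for cubes\<close>

text \<open>
  In the normalised variables \<open>y = x \<surd>(a / b)\<close> one has \<open>b x = c y\<close> and \<open>a x\<^sup>3 = c y\<^sup>3\<close> with the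
  weights \<open>c = b\<^sup>3\<^sup>/\<^sup>2 / a\<^sup>1\<^sup>/\<^sup>2\<close>, so that the claim is Jensen's inequality for the cube.
\<close>

lemma Holder_cube:
  fixes a b x :: "'i \<Rightarrow> real"
  assumes A: "finite A" "A \<noteq> {}"
    and a: "\<And>i. i \<in> A \<Longrightarrow> a i > 0" and b: "\<And>i. i \<in> A \<Longrightarrow> b i > 0"
    and x: "\<And>i. i \<in> A \<Longrightarrow> x i \<ge> 0"
  shows "(\<Sum>i\<in>A. b i * x i) ^ 3
      \<le> (\<Sum>i\<in>A. a i * x i ^ 3) * (\<Sum>i\<in>A. b i powr (3 / 2) / a i powr (1 / 2))\<^sup>2"
proof -
  define c where "c i = b i powr (3 / 2) / a i powr (1 / 2)" for i
  define y where "y i = x i * sqrt (a i / b i)" for i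
  define C where "C = sum c A"
  have c_eq: "c i = b i * sqrt (b i) / sqrt (a i)" if "i \<in> A" for i
    using powr_add[of "b i" 1 "1 / 2"] a[OF that] b[OF that]
    by (simp add: c_def powr_half_sqrt)
  have cy: "c i * y i = b i * x i" if "i \<in> A" for i
    using a[OF that] b[OF that] by (simp add: c_eq[OF that] y_def real_sqrt_divide)
  have cy3: "c i * y i ^ 3 = a i * x i ^ 3" if "i \<in> A" for i
  proof -
    have "(y i)\<^sup>2 = (x i)\<^sup>2 * (a i / b i)"
      using a[OF that] b[OF that] by (simp add: y_def power_mult_distrib)
    then have "c i * y i ^ 3 = (c i * y i) * ((x i)\<^sup>2 * (a i / b i))"
      by (simp add: power3_eq_cube power2_eq_square)
    then show ?thesis
      using b[OF that] by (simp add: cy[OF that] power3_eq_cube power2_eq_square)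
  qed
  have c_pos: "c i > 0" if "i \<in> A" for i
    using a[OF that] b[OF that] by (simp add: c_def)
  then have "C > 0" unfolding C_def using A by (intro sum_pos)
  have "(\<Sum>i\<in>A. (c i / C) *\<^sub>R y i) ^ 3 \<le> (\<Sum>i\<in>A. c i / C * y i ^ 3)"
  proof (rule convex_on_sum[OF A, of "{0..}" "\<lambda>y. y ^ 3"])
    show "convex_on {0::real..} (\<lambda>y. y ^ 3)" by (rule convex_power_odd) simp
    show "(\<Sum>i\<in>A. c i / C) = 1"
      using \<open>C > 0\<close> by (simp add: C_def flip: sum_divide_distrib)
    show "c i / C \<ge> 0" if "i \<in> A" for i
      using c_pos[OF that] \<open>C > 0\<close> by simp
    show "y i \<in> {0..}" if "i \<in> A" for i
      using a[OF that] b[OF that] x[OF that] by (simp add: y_def)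
  qed
  then have "((\<Sum>i\<in>A. c i * y i) / C) ^ 3 \<le> (\<Sum>i\<in>A. c i * y i ^ 3) / C"
    by (simp add: sum_divide_distrib)
  then have "(\<Sum>i\<in>A. c i * y i) ^ 3 \<le> (\<Sum>i\<in>A. c i * y i ^ 3) * C\<^sup>2"
    using \<open>C > 0\<close> by (simp add: field_simps power3_eq_cube power2_eq_square)
  then show ?thesis
    using cy cy3 by (simp add: C_def c_def)
qed

section \<open>The trace of the force and the force function\<close>

text \<open>
  In mass-weighted Jacobi coordinates Newton's equations read \<open>M'' = - M A\<close> with a 2 by 2 matrix \<open>M\<close> of positions
  and a symmetric matrix \<open>A\<close> that depends on the mutual distances only; the following is the trace
  of \<open>A\<close>.
\<close>

definition force_trace :: "real ^ 3 \<Rightarrow> complex ^ 3 \<Rightarrow> real" where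
  "force_trace m z =
     (m $ 3 + m $ 2) / norm (z $ 3 - z $ 2) ^ 3 +
     (m $ 1 + m $ 3) / norm (z $ 1 - z $ 3) ^ 3 +
     (m $ 2 + m $ 1) / norm (z $ 2 - z $ 1) ^ 3"

lemma force_trace_lower_bound:
  assumes m: "\<forall>k. m $ k > 0"
  shows "force_function m z ^ 3 \<le> force_trace m z * (mass_sum m)\<^sup>2"
proof -
  \<comment> \<open>The component \<open>i\<close> belongs to the pair of bodies other than \<open>i\<close>.\<close>
  define a :: "real ^ 3" where "a = vector [m $ 3 + m $ 2, m $ 1 + m $ 3, m $ 2 + m $ 1]"
  define b :: "real ^ 3" where "b = vector [m $ 3 * m $ 2, m $ 1 * m $ 3, m $ 2 * m $ 1]"
  define x :: "real ^ 3" where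
    "x = vector [1 / norm (z $ 3 - z $ 2), 1 / norm (z $ 1 - z $ 3), 1 / norm (z $ 2 - z $ 1)]"
  have "\<forall>i. a $ i > 0" "\<forall>i. b $ i > 0" "\<forall>i. x $ i \<ge> 0"
    using m by (simp_all add: forall_3 a_def b_def x_def add_pos_pos)
  then have "(\<Sum>i\<in>UNIV. b $ i * x $ i) ^ 3 \<le> (\<Sum>i\<in>UNIV. a $ i * (x $ i) ^ 3) *
      (\<Sum>i\<in>UNIV. (b $ i) powr (3 / 2) / (a $ i) powr (1 / 2))\<^sup>2"
    by (intro Holder_cube) auto
  then show ?thesis
    by (simp add: sum_3 a_def b_def x_def force_function_def force_trace_def mass_sum_def
        power_divide)
qed

section \<open>Oriented areas\<close>

definition area :: "complex \<Rightarrow> complex \<Rightarrow> real" where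
  "area x y = Re x * Im y - Im x * Re y"

lemma area_zero_imp_in_span:
  assumes "area x y = 0" "y \<noteq> 0"
  shows "x \<in> span {y}"
proof -
  have "x = ((Re x * Re y + Im x * Im y) / (norm y)\<^sup>2) *\<^sub>R y"
  proof -
    have "(norm y)\<^sup>2 *\<^sub>R x = (Re x * Re y + Im x * Im y) *\<^sub>R y"
    proof (rule complex_eqI)
      show "Re ((norm y)\<^sup>2 *\<^sub>R x) = Re ((Re x * Re y + Im x * Im y) *\<^sub>R y)"
        using assms(1) unfolding area_def cmod_power2 by simp algebra
      show "Im ((norm y)\<^sup>2 *\<^sub>R x) = Im ((Re x * Re y + Im x * Im y) *\<^sub>R y)"
        using assms(1) unfolding area_def cmod_power2 by simp algebra
    qed
    then have "x = inverse ((norm y)\<^sup>2) *\<^sub>R ((Re x * Re y + Im x * Im y) *\<^sub>R y)"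
      using assms(2) by (simp flip: \<open>(norm y)\<^sup>2 *\<^sub>R x = _\<close>)
    then show ?thesis
      by (simp add: divide_inverse mult.commute)
  qed
  then show ?thesis
    by (metis span_base span_scale singletonI)
qed

text \<open>
  Pairing the relation \<open>m\<^sub>1 w\<^sub>1 + m\<^sub>2 w\<^sub>2 + m\<^sub>3 w\<^sub>3 = 0\<close> with \<open>w\<^sub>1\<close> and with \<open>w\<^sub>2\<close> expresses all areas
  through the first one.
\<close>

lemma area_centred:
  fixes m :: "real ^ 3"
  assumes m: "\<forall>k. m $ k > 0" and w: "(\<Sum>k\<in>UNIV. (m $ k) *\<^sub>R (w $ k :: complex)) = 0"
  shows "area (w $ 1) (w $ 3) = - (m $ 2 / m $ 3) * area (w $ 1) (w $ 2)"
    and "area (w $ 2) (w $ 3) = m $ 1 / m $ 3 * area (w $ 1) (w $ 2)"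
proof -
  have "m $ 3 > 0" using m by simp
  have re: "m $ 1 * Re (w $ 1) + m $ 2 * Re (w $ 2) + m $ 3 * Re (w $ 3) = 0"
    using arg_cong[OF w, of Re] by (simp add: sum_3)
  have im: "m $ 1 * Im (w $ 1) + m $ 2 * Im (w $ 2) + m $ 3 * Im (w $ 3) = 0"
    using arg_cong[OF w, of Im] by (simp add: sum_3)
  have "m $ 3 * area (w $ 1) (w $ 3) = - (m $ 2) * area (w $ 1) (w $ 2)"
    using re im unfolding area_def by algebra
  then show "area (w $ 1) (w $ 3) = - (m $ 2 / m $ 3) * area (w $ 1) (w $ 2)"
    using \<open>m $ 3 > 0\<close> by (simp add: field_simps)
  have "m $ 3 * area (w $ 2) (w $ 3) = m $ 1 * area (w $ 1) (w $ 2)"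
    using re im unfolding area_def by algebra
  then show "area (w $ 2) (w $ 3) = m $ 1 / m $ 3 * area (w $ 1) (w $ 2)"
    using \<open>m $ 3 > 0\<close> by (simp add: field_simps)
qed

lemma area_swap: "area y x = - area x y"
  by (simp add: area_def)

lemma area_centred_proportional:
  fixes m :: "real ^ 3"
  assumes m: "\<forall>k. m $ k > 0"
  obtains c where "\<And>w. (\<Sum>k\<in>UNIV. (m $ k) *\<^sub>R (w $ k :: complex)) = 0 \<Longrightarrow>
    area (w $ j) (w $ k) = c * area (w $ 1) (w $ 2)"
proof -
  have "\<exists>c. \<forall>w. (\<Sum>k\<in>UNIV. (m $ k) *\<^sub>R (w $ k :: complex)) = 0 \<longrightarrow>
      area (w $ j) (w $ k) = c * area (w $ 1) (w $ 2)"
  proof -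
    consider "j = k" | "j = 1 \<and> k = 2" | "j = 1 \<and> k = 3" | "j = 2 \<and> k = 3"
      | "j = 2 \<and> k = 1" | "j = 3 \<and> k = 1" | "j = 3 \<and> k = 2"
      using exhaust_3[of j] exhaust_3[of k] by metis
    then show ?thesis
    proof cases
      case 1 then show ?thesis by (intro exI[of _ 0]) (simp add: area_def)
    next
      case 2 then show ?thesis by (intro exI[of _ 1]) simp
    next
      case 3 then show ?thesis using area_centred(1)[OF m] by blast
    next
      case 4 then show ?thesis using area_centred(2)[OF m] by blast
    next
      case 5 then show ?thesis
        by (intro exI[of _ "-1"]) (simp add: area_swap[of "_ $ 2"])
    next
      case 6 then show ?thesis using area_centred(1)[OF m]
        by (intro exI[of _ "m $ 2 / m $ 3"]) (simp add: area_swap[of "_ $ 3"])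
    next
      case 7 then show ?thesis using area_centred(2)[OF m]
        by (intro exI[of _ "- (m $ 1 / m $ 3)"]) (simp add: area_swap[of "_ $ 3"])
    qed
  qed
  then show thesis using that by blast
qed

lemma on_line_through_origin_if_area_zero:
  assumes m: "\<forall>k. m $ k > 0" and w: "(\<Sum>k\<in>UNIV. (m $ k) *\<^sub>R (w $ k)) = 0"
    and zero: "area (w $ 1) (w $ 2) = 0"
  shows "on_line_through_origin w"
proof (cases "\<exists>j. w $ j \<noteq> 0")
  case True
  then obtain j where "w $ j \<noteq> 0" ..
  have "area (w $ k) (w $ j) = 0" for k
    using area_centred_proportional[OF m, of k j] w zero by (metis mult_zero_right)
  then have "\<forall>k. w $ k \<in> span {w $ j}"
    using area_zero_imp_in_span \<open>w $ j \<noteq> 0\<close> by blast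
  with \<open>w $ j \<noteq> 0\<close> show ?thesis
    unfolding on_line_through_origin_def by blast
next
  case False
  then show ?thesis
    unfolding on_line_through_origin_def by (intro exI[of _ 1]) (simp add: span_zero)
qed

text \<open>
  Positions and velocities have the same factor of proportionality; in the product it is squared.
\<close>

lemma antisymmetric_configuration_area:
  assumes m: "\<forall>k. m $ k > 0"
    and z: "(\<Sum>k\<in>UNIV. (m $ k) *\<^sub>R (z $ k)) = 0" and v: "(\<Sum>k\<in>UNIV. (m $ k) *\<^sub>R (v $ k)) = 0"
    and anti: "antisymmetric_configuration z v"
  shows "area (z $ 1) (z $ 2) * area (v $ 1) (v $ 2) < 0"
proof -
  obtain j k where neg: "area (z $ j) (z $ k) * area (v $ j) (v $ k) < 0"
    using anti unfolding antisymmetric_configuration_def area_def by blast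
  obtain c where "\<And>w. (\<Sum>k\<in>UNIV. (m $ k) *\<^sub>R (w $ k :: complex)) = 0 \<Longrightarrow>
      area (w $ j) (w $ k) = c * area (w $ 1) (w $ 2)"
    using area_centred_proportional[OF m] by blast
  with neg z v have "c\<^sup>2 * (area (z $ 1) (z $ 2) * area (v $ 1) (v $ 2)) < 0"
    by (simp add: power2_eq_square mult_ac)
  then show ?thesis
    by (metis mult_nonneg_nonneg not_less zero_le_power2)
qed

section \<open>Solutions of the three-body problem\<close>

lemma has_real_derivative_area:
  assumes "(x has_vector_derivative x') (at t within I)" "(y has_vector_derivative y') (at t within I)"
  shows "((\<lambda>t. area (x t) (y t)) has_real_derivative area x' (y t) + area (x t) y') (at t within I)"
proof -
  have re: "((\<lambda>t. Re (x t)) has_real_derivative Re x') (at t within I)"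
      "((\<lambda>t. Re (y t)) has_real_derivative Re y') (at t within I)"
    and im: "((\<lambda>t. Im (x t)) has_real_derivative Im x') (at t within I)"
      "((\<lambda>t. Im (y t)) has_real_derivative Im y') (at t within I)"
    using assms unfolding has_vector_derivative_complex_iff by blast+
  show ?thesis
    unfolding area_def
    by (rule derivative_eq_intros re im refl)+ (simp add: algebra_simps)
qed

text \<open>
  Each force is a multiple of a mutual difference, so the left-hand side is a combination of the
  areas of the three pairs of bodies, and these are multiples of the first one.
\<close>

lemma area_acceleration:
  assumes m: "\<forall>k. m $ k > 0" and z: "(\<Sum>k\<in>UNIV. (m $ k) *\<^sub>R (z $ k)) = 0"
  shows "area (acceleration m z $ 1) (z $ 2) + area (z $ 1) (acceleration m z $ 2) =
    - force_trace m z * area (z $ 1) (z $ 2)"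
proof -
  define p q r where "p = inverse (norm (z $ 2 - z $ 1) ^ 3)"
    and "q = inverse (norm (z $ 1 - z $ 3) ^ 3)" and "r = inverse (norm (z $ 3 - z $ 2) ^ 3)"
  have "m $ 3 > 0" using m by simp
  have 13: "m $ 3 * area (z $ 1) (z $ 3) = - (m $ 2) * area (z $ 1) (z $ 2)"
    and 23: "m $ 3 * area (z $ 2) (z $ 3) = m $ 1 * area (z $ 1) (z $ 2)"
    using area_centred[OF m z] \<open>m $ 3 > 0\<close> by simp_all
  have "area (acceleration m z $ 1) (z $ 2) + area (z $ 1) (acceleration m z $ 2) =
      - (m $ 2 * p) * area (z $ 1) (z $ 2)
      - q * (m $ 3 * area (z $ 1) (z $ 2) + m $ 3 * area (z $ 2) (z $ 3))
      + r * (m $ 3 * area (z $ 1) (z $ 3) - m $ 3 * area (z $ 1) (z $ 2))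
      - (m $ 1 * p) * area (z $ 1) (z $ 2)"
    by (simp add: acceleration_def Let_def area_def algebra_simps flip: p_def q_def r_def)
  also have "\<dots> = - force_trace m z * area (z $ 1) (z $ 2)"
    unfolding 13 23 force_trace_def divide_inverse p_def[symmetric] q_def[symmetric] r_def[symmetric]
    by (simp add: algebra_simps)
  finally show ?thesis .
qed

lemma has_real_derivative_inverse_norm:
  fixes x :: "real \<Rightarrow> 'a :: real_inner"
  assumes "(x has_vector_derivative x') (at t within I)" "x t \<noteq> 0"
  shows "((\<lambda>t. c / norm (x t)) has_real_derivative - c * inner (x t) x' / norm (x t) ^ 3)
    (at t within I)"
proof -
  have d: "((\<lambda>t. inner (x t) (x t)) has_real_derivative 2 * inner (x t) x') (at t within I)"
    using assms(1) unfolding has_vector_derivative_def has_field_derivative_def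
    by (auto intro!: derivative_eq_intros simp: inner_commute algebra_simps fun_eq_iff)
  have "inner (x t) (x t) > 0" "\<not> inner (x t) (x t) < 0"
    using assms(2) by (simp_all add: not_less)
  then have "((\<lambda>t. c / sqrt (inner (x t) (x t))) has_real_derivative
      - c * inner (x t) x' / sqrt (inner (x t) (x t)) ^ 3) (at t within I)"
    by (auto intro!: derivative_eq_intros d simp: field_simps power3_eq_cube)
  then show ?thesis by (simp add: norm_eq_sqrt_inner)
qed

lemma has_real_derivative_norm_square:
  fixes x :: "real \<Rightarrow> 'a :: real_inner"
  assumes "(x has_vector_derivative x') (at t within I)"
  shows "((\<lambda>t. norm (x t) ^ 2) has_real_derivative 2 * inner (x t) x') (at t within I)"
  using assms unfolding has_vector_derivative_def has_field_derivative_def power2_norm_eq_inner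
  by (auto intro!: derivative_eq_intros simp: inner_commute algebra_simps fun_eq_iff)

lemma three_body_solution_component:
  assumes "three_body_solution_on I m z v" "t \<in> I"
  shows "((\<lambda>t. z t $ k) has_vector_derivative v t $ k) (at t within I)"
    and "((\<lambda>t. v t $ k) has_vector_derivative acceleration m (z t) $ k) (at t within I)"
  using assms bounded_linear.has_vector_derivative[OF bounded_linear_vec_nth]
  unfolding three_body_solution_on_def by blast+

lemma energy_conserved:
  assumes sol: "three_body_solution_on I m z v" and free: "collision_free_on I z"
    and I: "convex I" "s \<in> I" "t \<in> I"
  shows "energy m (z t) (v t) = energy m (z s) (v s)"
proof -
  have "((\<lambda>t. energy m (z t) (v t)) has_real_derivative 0) (at t within I)" if t: "t \<in> I" for t
  proof -
    note z = three_body_solution_component(1)[OF sol t]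
    note v = three_body_solution_component(2)[OF sol t]
    define p q r where "p = inverse (norm (z t $ 2 - z t $ 1) ^ 3)"
      and "q = inverse (norm (z t $ 1 - z t $ 3) ^ 3)"
      and "r = inverse (norm (z t $ 3 - z t $ 2) ^ 3)"
    have ne: "z t $ 2 - z t $ 1 \<noteq> 0" "z t $ 1 - z t $ 3 \<noteq> 0" "z t $ 3 - z t $ 2 \<noteq> 0"
      using free t unfolding collision_free_on_def by auto
    note U' = has_real_derivative_inverse_norm[OF has_vector_derivative_diff[OF z z]]
    note K' = has_real_derivative_norm_square[OF v]
    define E' where "E' =
      1 / 2 * (m $ 1 * (2 * inner (v t $ 1) (acceleration m (z t) $ 1)) +
               m $ 2 * (2 * inner (v t $ 2) (acceleration m (z t) $ 2)) +
               m $ 3 * (2 * inner (v t $ 3) (acceleration m (z t) $ 3))) -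
      (- (m $ 3 * m $ 2) * inner (z t $ 3 - z t $ 2) (v t $ 3 - v t $ 2) / norm (z t $ 3 - z t $ 2) ^ 3
       + - (m $ 1 * m $ 3) * inner (z t $ 1 - z t $ 3) (v t $ 1 - v t $ 3) / norm (z t $ 1 - z t $ 3) ^ 3
       + - (m $ 2 * m $ 1) * inner (z t $ 2 - z t $ 1) (v t $ 2 - v t $ 1) / norm (z t $ 2 - z t $ 1) ^ 3)"
    have "((\<lambda>t. energy m (z t) (v t)) has_real_derivative E') (at t within I)"
      unfolding energy_def kinetic_energy_def force_function_def sum_3 E'_def
      by (intro DERIV_diff DERIV_add DERIV_cmult K' U' ne)
    \<comment> \<open>For each pair of bodies, the power of the mutual forces is the rate of change of its term in \<open>U\<close>.\<close>
    moreover have "E' = 0"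
      unfolding E'_def divide_inverse acceleration_def Let_def vector_3
        p_def[symmetric] q_def[symmetric] r_def[symmetric]
      by (simp add: inner_commute algebra_simps)
    ultimately show ?thesis by simp
  qed
  then obtain c where "\<forall>t\<in>I. energy m (z t) (v t) = c"
    using has_field_derivative_zero_constant[OF I(1)] by blast
  then show ?thesis using I by simp
qed

section \<open>Existence of a generalised syzygy\<close>

lemma continuous_nonzero_keeps_sign:
  fixes f :: "real \<Rightarrow> real"
  assumes "continuous_on {a..b} f" "\<And>t. t \<in> {a..b} \<Longrightarrow> f t \<noteq> 0" "f a > 0" "t \<in> {a..b}"
  shows "f t > 0"
proof (rule ccontr)
  assume "\<not> f t > 0"
  moreover have "continuous_on {a..t} f"
    using assms(1,4) by (auto intro: continuous_on_subset)
  ultimately obtain s where "a \<le> s" "s \<le> t" "f s = 0"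
    using IVT2'[of f t 0 a] assms(3,4) by auto
  then show False using assms(2)[of s] assms(4) by auto
qed

theorem theorem4p1:
  fixes m :: "real ^ 3" and \<alpha> T :: real and z v :: "real \<Rightarrow> complex ^ 3"
  assumes "\<forall>k. m $ k > 0"
    and "\<alpha> > 0"
    and "T = pi * mass_sum m / \<alpha> powr (3 / 2)"
    and "three_body_solution_on {0..T} m z v"
    and "collision_free_on {0..T} z"
    and "\<forall>t\<in>{0..T}. (\<Sum>k\<in>UNIV. (m $ k) *\<^sub>R (z t $ k)) = 0 \<and> (\<Sum>k\<in>UNIV. (m $ k) *\<^sub>R (v t $ k)) = 0"
    and "energy m (z 0) (v 0) = - \<alpha>"
    and "antisymmetric_configuration (z 0) (v 0)"
  shows "\<exists>t\<^sub>0\<in>{0..T}. generalised_syzygy (z t\<^sub>0) (v t\<^sub>0)"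
proof (rule ccontr)
  assume no_syzygy: "\<not> ?thesis"
  note m = assms(1) and sol = assms(4)
  have zc: "(\<Sum>k\<in>UNIV. (m $ k) *\<^sub>R (z t $ k)) = 0"
    and vc: "(\<Sum>k\<in>UNIV. (m $ k) *\<^sub>R (v t $ k)) = 0" if "t \<in> {0..T}" for t
    using assms(6) that by auto
  have "mass_sum m > 0"
    using m[rule_format, of 1] m[rule_format, of 2] m[rule_format, of 3]
    by (simp add: mass_sum_def add_pos_pos)
  define \<omega> where "\<omega> = \<alpha> powr (3 / 2) / mass_sum m"
  have "\<omega> > 0" using \<open>mass_sum m > 0\<close> assms(2) by (simp add: \<omega>_def)
  have T: "T = pi / \<omega>" using assms(3) by (simp add: \<omega>_def)
  have "T > 0" using T \<open>\<omega> > 0\<close> by simp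
  define S where "S t = area (z t $ 1) (z t $ 2)" for t
  define W where "W t = area (v t $ 1) (v t $ 2)" for t
  define S' where "S' t = area (v t $ 1) (z t $ 2) + area (z t $ 1) (v t $ 2)" for t
  have SW_nonzero: "S t * W t \<noteq> 0" if "t \<in> {0..T}" for t
    using no_syzygy that on_line_through_origin_if_area_zero[OF m zc[OF that]]
      on_line_through_origin_if_area_zero[OF m vc[OF that]]
    by (auto simp: S_def W_def generalised_syzygy_def)
  note zd = three_body_solution_component(1)[OF sol]
  note vd = three_body_solution_component(2)[OF sol]
  have S': "(S has_real_derivative S' t) (at t within {0..T})" if "t \<in> {0..T}" for t
    unfolding S_def S'_def by (intro has_real_derivative_area zd that)
  have S'': "(S' has_real_derivative 2 * W t - force_trace m (z t) * S t) (at t within {0..T})"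
    if t: "t \<in> {0..T}" for t
  proof -
    have "(S' has_real_derivative
        (area (acceleration m (z t) $ 1) (z t $ 2) + area (v t $ 1) (v t $ 2)) +
        (area (v t $ 1) (v t $ 2) + area (z t $ 1) (acceleration m (z t) $ 2))) (at t within {0..T})"
      (is "(_ has_real_derivative ?D) _")
      unfolding S'_def by (intro DERIV_add has_real_derivative_area zd vd t)
    moreover have "?D = 2 * W t - force_trace m (z t) * S t"
      using area_acceleration[OF m zc[OF t]] by (simp add: S_def W_def)
    ultimately show ?thesis by simp
  qed
  have "continuous_on {0..T} S"
    using S' by (rule DERIV_continuous_on)
  moreover have "continuous_on {0..T} W"
    unfolding W_def using has_real_derivative_area[OF vd vd] by (rule DERIV_continuous_on)
  ultimately have cont: "continuous_on {0..T} S" "continuous_on {0..T} (\<lambda>t. - (S t * W t))"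
    by (simp_all add: continuous_on_mult continuous_on_minus)
  have "S 0 * W 0 < 0"
    using antisymmetric_configuration_area[OF m zc vc assms(8)] \<open>T > 0\<close> by (simp add: S_def W_def)
  then have SW: "S t * W t < 0" if "t \<in> {0..T}" for t
    using continuous_nonzero_keeps_sign[OF cont(2), of t] SW_nonzero that by auto
  have trace: "force_trace m (z t) \<ge> \<omega>\<^sup>2" if t: "t \<in> {0..T}" for t
  proof -
    have "energy m (z t) (v t) = - \<alpha>"
      using energy_conserved[OF sol assms(5), of 0 t] assms(7) t by auto
    moreover have "kinetic_energy m (v t) \<ge> 0"
      unfolding kinetic_energy_def using m by (intro mult_nonneg_nonneg sum_nonneg) (auto simp: less_imp_le)
    ultimately have "\<alpha> \<le> force_function m (z t)" by (simp add: energy_def)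
    then have "\<alpha> ^ 3 \<le> force_function m (z t) ^ 3" using assms(2) by (intro power_mono) auto
    also have "\<dots> \<le> force_trace m (z t) * (mass_sum m)\<^sup>2" by (rule force_trace_lower_bound[OF m])
    finally have "\<alpha> ^ 3 / (mass_sum m)\<^sup>2 \<le> force_trace m (z t)"
      using \<open>mass_sum m > 0\<close> by (simp add: field_simps)
    moreover have "(\<alpha> powr (3 / 2))\<^sup>2 = \<alpha> ^ 3"
      using assms(2) by (simp add: power2_eq_square flip: powr_add)
    ultimately show ?thesis by (simp add: \<omega>_def power_divide)
  qed
  \<comment> \<open>The overall sign that makes \<open>S\<close> positive.\<close>
  define \<sigma> where "\<sigma> = sgn (S 0)"
  have \<sigma>S: "\<sigma> * S t > 0" if "t \<in> {0..T}" for t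
  proof (rule continuous_nonzero_keeps_sign[OF _ _ _ that])
    show "continuous_on {0..T} (\<lambda>t. \<sigma> * S t)" using cont(1) by (intro continuous_intros)
    show "\<sigma> * S t \<noteq> 0" if "t \<in> {0..T}" for t
      using SW_nonzero[OF that] SW_nonzero[of 0] \<open>T > 0\<close> by (auto simp: \<sigma>_def sgn_eq_0_iff)
    show "\<sigma> * S 0 > 0"
      using SW_nonzero[of 0] \<open>T > 0\<close> by (simp add: \<sigma>_def sgn_if)
  qed
  show False
  proof (rule no_positive_solution_on_half_period[OF \<open>\<omega> > 0\<close> T])
    fix t assume t: "t \<in> {0..T}"
    show "((\<lambda>t. \<sigma> * S t) has_real_derivative \<sigma> * S' t) (at t within {0..T})"
      by (intro DERIV_cmult S' t)
    show "((\<lambda>t. \<sigma> * S' t) has_real_derivative \<sigma> * (2 * W t - force_trace m (z t) * S t))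
        (at t within {0..T})"
      by (intro DERIV_cmult S'' t)
    show "\<sigma> * S t > 0" by (rule \<sigma>S[OF t])
    have "\<sigma> * W t < 0"
      using \<sigma>S[OF t] SW[OF t] by (auto simp: zero_less_mult_iff mult_less_0_iff)
    moreover have "\<omega>\<^sup>2 * (\<sigma> * S t) \<le> force_trace m (z t) * (\<sigma> * S t)"
      using trace[OF t] \<sigma>S[OF t] by (intro mult_right_mono) auto
    ultimately show "\<sigma> * (2 * W t - force_trace m (z t) * S t) \<le> - (\<omega>\<^sup>2 * (\<sigma> * S t))"
      by (simp add: algebra_simps)
  qed
qed

end
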